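(* Let $x,y\in[0,\infty)^n$ and fix an integer $r\ge1$. If $F_{k,r}(x)\le F_{k,r}(y)$ for all integers $k$ in the interval $r\le k\le nr$, then $$\|x\|_p\le\|y\|_p\qquad\text{for all real } p \text{ with } 0\le p\le1,$$ and, if in addition $\sum_i x_i=\sum_i y_i$, then $$\|x\|_p\ge\|y\|_p\qquad\text{for all real } p\text{ with } 1\le p\le r+1 .$$
   Context: For integers $k,r\ge 1$, the polynomial $F_{k,r}$ in $n$ variables is $$F_{k,r}(x_1,\dots,x_n)=\sum_{k_1+\dots+k_n=k,\ \max_i k_i\le r}\ \prod_{i=1}^n\frac{x_i^{k_i}}{k_i!},$$ where the $k_i$ range over nonnegative integers (so $F_{k,r}(x)$ is the coefficient of $t^k$ in $\prod_{i=1}^n\left(1+x_it+\dots+\frac{(x_it)^r}{r!}\right)$). For $x\in[0,\infty)^n$ and $0<p<\infty$, $\|x\|_p=\left(\sum_{i=1}^n x_i^p\right)^{1/p}$ (normalizing the sum by $1/n$ makes no difference to the inequalities), and $\|x\|_0=\left(\prod_{i=1}^n x_i\right)^{1/n}$ is the geometric mean. *)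

theory Defs
  imports "HOL-Analysis.Analysis"
begin

definition F :: "nat \<Rightarrow> nat \<Rightarrow> real ^ 'n \<Rightarrow> real" where
  "F k r x = (\<Sum>\<kappa> | (\<Sum>i\<in>UNIV. \<kappa> i) = k \<and> (\<forall>i. \<kappa> i \<le> r).
                \<Prod>i\<in>UNIV. (x $ i) ^ \<kappa> i / fact (\<kappa> i))"

text \<open>The index set in the definition of \<open>F\<close> is finite, so the sum is a genuine one.\<close>

lemma finite_F_index:
  "finite {\<kappa> :: 'n::finite \<Rightarrow> nat. (\<Sum>i\<in>UNIV. \<kappa> i) = k \<and> (\<forall>i. \<kappa> i \<le> r)}"
proof (rule finite_subset)
  show "finite (PiE (UNIV :: 'n set) (\<lambda>_. {..r}))"
    by (rule finite_PiE) auto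
qed (auto simp: PiE_def Pi_def)

text \<open>Only meant for vectors with nonnegative entries and \<open>p \<ge> 0\<close>. Note that \<open>0 powr p = 0\<close>,
  so zero entries contribute nothing to the sum when \<open>p > 0\<close>.\<close>

definition pnorm :: "real \<Rightarrow> real ^ 'n \<Rightarrow> real" where
  "pnorm p x = (if p = 0 then (\<Prod>i\<in>UNIV. x $ i) powr (1 / real CARD('n))
                else (\<Sum>i\<in>UNIV. (x $ i) powr p) powr (1 / p))"

end

theory Submission
  imports Defs
begin

text \<open>
  Let \<open>E t = 1 + t + \<dots> + t^r / r!\<close> be the truncated exponential series. The values \<open>F k r x\<close> are
  the coefficients of the polynomial \<open>\<Prod>i. E (x\<^sub>i t)\<close> in \<open>t\<close> (\<open>F_generating_function\<close>). For
  \<open>k \<le> r\<close> the truncation is invisible and \<open>F k r x = (\<Sum>i. x\<^sub>i)^k / k!\<close> (\<open>F_low_degree\<close>), so the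
  hypothesis at \<open>k = r\<close> says that \<open>\<Sum>i. x\<^sub>i \<le> \<Sum>i. y\<^sub>i\<close> and thereby supplies the coefficient
  inequalities below \<open>r\<close> as well. Comparing coefficients and taking logarithms gives, for all
  \<open>t > 0\<close>,
  \<open>(\<Sum>i. ln (E (x\<^sub>i t))) \<le> (\<Sum>i. ln (E (y\<^sub>i t)))\<close>.

  To turn this into power sums, integrate against the scale-covariant weight \<open>t powr (-p-1)\<close> on
  the positive half-line: substituting \<open>s = c t\<close> shows that the integral of \<open>g (c t)\<close> is
  \<open>c powr p\<close> times the integral \<open>M\<close> of \<open>g t\<close>, and \<open>M\<close> cancels as soon as it is positive
  and finite (\<open>sum_powr_le_by_Mellin\<close>). The two ranges of \<open>p\<close> are the ranges of convergence
  for two choices of \<open>g\<close>: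

  \<^item> \<open>g t = ln (E t)\<close> behaves like \<open>t\<close> at \<open>0\<close> and like \<open>r ln t\<close> at infinity, so every
    \<open>0 < p < 1\<close> is admissible.

  \<^item> \<open>g t = t - ln (E t)\<close> behaves like \<open>t ^ (r + 1) / (r + 1)!\<close> at \<open>0\<close> and like \<open>t\<close> at
    infinity, so every \<open>1 < p < r + 1\<close> is admissible. When the two sums of entries agree,
    subtracting reverses the inequality, which is why the conclusion flips beyond \<open>1\<close>.

  The endpoints are separate: \<open>p = 1\<close> compares the sums of the entries, \<open>p = r + 1\<close> is a limit
  of smaller exponents, and \<open>p = 0\<close> is the hypothesis on the leading coefficient
  \<open>F (n r) r x = (\<Prod>i. x\<^sub>i)^r / (r!)^n\<close> (\<open>F_top_degree\<close>).
\<close>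

section \<open>The polynomials as coefficients of products of truncated exponentials\<close>

definition exp_trunc :: "nat \<Rightarrow> real \<Rightarrow> real" where
  "exp_trunc r t = (\<Sum>j\<le>r. t ^ j / fact j)"

lemma exp_trunc_0: "exp_trunc r 0 = 1"
  by (simp add: exp_trunc_def power_0_left if_distrib[of "\<lambda>u. u / _"] cong: if_cong)

lemma F_generating_function:
  fixes x :: "real ^ 'n"
  shows "(\<Prod>i\<in>UNIV. exp_trunc r (x $ i * t)) = (\<Sum>k\<le>CARD('n) * r. F k r x * t ^ k)"
proof -
  let ?T = "PiE (UNIV :: 'n set) (\<lambda>_. {..r})"
  let ?f = "\<lambda>\<kappa>. \<Prod>i\<in>UNIV. (x $ i) ^ \<kappa> i / fact (\<kappa> i)"
  have T: "?T = {\<kappa>. \<forall>i. \<kappa> i \<le> r}"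
    by (auto simp: PiE_def Pi_def)
  have "(\<Prod>i\<in>UNIV. exp_trunc r (x $ i * t))
        = (\<Sum>\<kappa>\<in>?T. \<Prod>i\<in>UNIV. (x $ i * t) ^ \<kappa> i / fact (\<kappa> i))"
    unfolding exp_trunc_def by (rule prod_sum_PiE) auto
  also have "\<dots> = (\<Sum>\<kappa>\<in>?T. ?f \<kappa> * t ^ (\<Sum>i\<in>UNIV. \<kappa> i))"
    by (simp add: power_mult_distrib power_sum prod.distrib prod_dividef)
  also have "\<dots> = (\<Sum>k\<le>CARD('n) * r. \<Sum>\<kappa> | \<kappa> \<in> ?T \<and> (\<Sum>i\<in>UNIV. \<kappa> i) = k.
                      ?f \<kappa> * t ^ (\<Sum>i\<in>UNIV. \<kappa> i))"
  proof (rule sum.group [symmetric])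
    show "finite ?T" by (rule finite_PiE) auto
    show "(\<lambda>\<kappa>. \<Sum>i\<in>UNIV. \<kappa> i) ` ?T \<subseteq> {..CARD('n) * r}"
      using sum_bounded_above[where A = "UNIV :: 'n set" and K = r] by (auto simp: T)
  qed auto
  also have "\<dots> = (\<Sum>k\<le>CARD('n) * r. F k r x * t ^ k)"
    unfolding F_def sum_distrib_right by (intro sum.cong) (auto simp: T)
  finally show ?thesis .
qed

text \<open>
  A multi-index of total degree \<open>k \<le> r\<close> has no entry above \<open>r\<close>, so the bound on the entries can
  be dropped; what remains is the coefficient of a product of full exponential series, that is,
  of the single series \<open>fps_exp (\<Sum>i. x\<^sub>i)\<close>. Multi-indices are identified with multisets over the
  index type to match the coefficient formula for products of formal power series.
\<close>

lemma F_low_degree: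
  fixes x :: "real ^ 'n"
  assumes "k \<le> r"
  shows "F k r x = (\<Sum>i\<in>UNIV. x $ i) ^ k / fact k"
proof -
  let ?I = "{\<kappa> :: 'n \<Rightarrow> nat. (\<Sum>i\<in>UNIV. \<kappa> i) = k \<and> (\<forall>i. \<kappa> i \<le> r)}"
  have "F k r x = (\<Sum>X\<in>multisets_of_size UNIV k. \<Prod>i\<in>UNIV. (x $ i) ^ count X i / fact (count X i))"
    unfolding F_def
  proof (rule sum.reindex_bij_witness[where i = count and j = Abs_multiset])
    fix X :: "'n multiset" assume "X \<in> multisets_of_size UNIV k"
    moreover have "(\<Sum>i\<in>UNIV. count X i) = (\<Sum>i\<in>set_mset X. count X i)"
      by (rule sum.mono_neutral_right) (auto simp: not_in_iff)
    ultimately have X: "(\<Sum>i\<in>UNIV. count X i) = k"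
      by (simp add: multisets_of_size_def size_multiset_overloaded_eq)
    moreover have "count X i \<le> r" for i
      using member_le_sum[of i UNIV "count X"] X assms by simp
    ultimately show "count X \<in> ?I" by simp
  next
    fix \<kappa> assume k: "\<kappa> \<in> ?I"
    have c: "count (Abs_multiset \<kappa>) = \<kappa>" by (rule count_Abs_multiset) simp
    show "count (Abs_multiset \<kappa>) = \<kappa>" by (rule c)
    have "(\<Sum>i\<in>set_mset (Abs_multiset \<kappa>). \<kappa> i) = (\<Sum>i\<in>UNIV. \<kappa> i)"
      by (rule sum.mono_neutral_left) (auto simp: c simp flip: count_greater_zero_iff)
    then show "Abs_multiset \<kappa> \<in> multisets_of_size UNIV k"
      using k by (simp add: multisets_of_size_def size_multiset_overloaded_eq c)
    show "(\<Prod>i\<in>UNIV. (x $ i) ^ count (Abs_multiset \<kappa>) i / fact (count (Abs_multiset \<kappa>) i))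
        = (\<Prod>i\<in>UNIV. (x $ i) ^ \<kappa> i / fact (\<kappa> i))" by (simp add: c)
  qed (simp add: count_inverse)
  also have "\<dots> = fps_nth (\<Prod>i\<in>UNIV. fps_exp (x $ i)) k"
    by (simp add: fps_prod_nth')
  also have "(\<Prod>i\<in>A. fps_exp (x $ i)) = fps_exp (\<Sum>i\<in>A. x $ i)" if "finite A" for A
    using that by induction (simp_all add: fps_exp_add_mult)
  then have "fps_nth (\<Prod>i\<in>UNIV. fps_exp (x $ i)) k = (\<Sum>i\<in>UNIV. x $ i) ^ k / fact k"
    by simp
  finally show ?thesis .
qed

text \<open>In the extreme degree \<open>n r\<close> every entry of the multi-index is forced to be \<open>r\<close>.\<close>

lemma F_top_degree:
  fixes x :: "real ^ 'n"
  shows "F (CARD('n) * r) r x = (\<Prod>i\<in>UNIV. x $ i) ^ r / fact r ^ CARD('n)"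
proof -
  have "\<kappa> = (\<lambda>_. r)" if total: "(\<Sum>i\<in>UNIV. \<kappa> i) = CARD('n) * r" and le: "\<forall>i. \<kappa> i \<le> r" for \<kappa> :: "'n \<Rightarrow> nat"
  proof (rule ccontr)
    assume "\<kappa> \<noteq> (\<lambda>_. r)"
    then obtain j where "\<kappa> j < r" using le by (metis ext le_neq_implies_less)
    then have "(\<Sum>i\<in>UNIV. \<kappa> i) < (\<Sum>i\<in>(UNIV::'n set). r)"
      using le by (intro sum_strict_mono_ex1) auto
    then show False using total by simp
  qed
  then have "{\<kappa> :: 'n \<Rightarrow> nat. (\<Sum>i\<in>UNIV. \<kappa> i) = CARD('n) * r \<and> (\<forall>i. \<kappa> i \<le> r)} = {\<lambda>_. r}"
    by auto
  then show ?thesis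
    by (simp add: F_def prod_dividef prod_power_distrib)
qed

section \<open>Growth of the truncated exponential\<close>

lemma exp_trunc_ge_1: "0 \<le> t \<Longrightarrow> 1 \<le> exp_trunc r t"
  using member_le_sum[of 0 "{..r}" "\<lambda>j. t ^ j / fact j"] by (simp add: exp_trunc_def)

lemma exp_trunc_gt_1: "1 \<le> r \<Longrightarrow> 0 < t \<Longrightarrow> 1 < exp_trunc r t"
proof -
  assume "1 \<le> r" "0 < t"
  then have "(\<Sum>j\<in>{0,1}. t ^ j / fact j) \<le> exp_trunc r t"
    unfolding exp_trunc_def by (intro sum_mono2) auto
  then show ?thesis using \<open>0 < t\<close> by simp
qed

text \<open>
  Both parts come from the Lagrange remainder \<open>exp s * t ^ (r + 1) / (r + 1)!\<close> with
  \<open>\<bar>s\<bar> < t\<close>. The first makes \<open>t - ln (exp_trunc r t)\<close> positive; the second makes it vanish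
  to order \<open>r + 1\<close> at \<open>0\<close>, which is where the upper limit \<open>r + 1\<close> for the exponent comes from.
\<close>

lemma exp_trunc_remainder:
  assumes "0 < t"
  shows "exp_trunc r t < exp t" "exp t - exp_trunc r t \<le> exp t * t ^ Suc r"
proof -
  obtain s where s: "\<bar>s\<bar> < \<bar>t\<bar>"
      "exp t = (\<Sum>m<Suc r. t ^ m / fact m) + exp s / fact (Suc r) * t ^ Suc r"
    using Maclaurin_exp_lt[of t "Suc r"] assms by auto
  then have eq: "exp t - exp_trunc r t = exp s / fact (Suc r) * t ^ Suc r"
    by (simp add: exp_trunc_def lessThan_Suc_atMost)
  moreover have "0 < exp s / fact (Suc r) * t ^ Suc r"
    using assms by simp
  ultimately show "exp_trunc r t < exp t" by linarith
  have "exp s / fact (Suc r) \<le> exp s / 1"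
    by (intro divide_left_mono) (auto simp: fact_ge_1 simp del: fact_Suc)
  also have "\<dots> \<le> exp t" using s(1) assms by simp
  finally show "exp t - exp_trunc r t \<le> exp t * t ^ Suc r"
    unfolding eq using assms by (intro mult_right_mono) auto
qed

text \<open>
  The logarithm of a polynomial grows more slowly than any positive power; a bound by a power
  rather than by a logarithm is what \<open>Mellin_integral_finite\<close> asks for.
\<close>

lemma ln_exp_trunc_bound_at_top:
  assumes "0 < s" "1 \<le> t"
  shows "ln (exp_trunc r t) \<le> (1 + r / s) * t powr s"
proof -
  have "exp_trunc r t \<le> (\<Sum>j\<le>r. t ^ r * (1 ^ j / fact j))"
    unfolding exp_trunc_def using assms(2)
    by (intro sum_mono) (auto simp: divide_right_mono power_increasing)
  also have "\<dots> = t ^ r * exp_trunc r 1"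
    by (simp add: exp_trunc_def sum_distrib_left)
  also have "\<dots> \<le> t ^ r * exp 1"
    using exp_trunc_remainder(1)[of 1 r] assms(2) by (intro mult_left_mono) auto
  finally have "exp_trunc r t \<le> t ^ r * exp 1" .
  then have "ln (exp_trunc r t) \<le> ln (t ^ r * exp 1)"
    using assms(2) exp_trunc_ge_1[of t r] by (intro ln_mono) auto
  also have "\<dots> = r * ln t + 1"
    using assms(2) by (simp add: ln_mult ln_realpow)
  also have "\<dots> \<le> r * (t powr s / s) + t powr s"
    using assms by (intro add_mono mult_left_mono ln_powr_bound ge_one_powr_ge_zero) auto
  finally show ?thesis by (simp add: algebra_simps)
qed

section \<open>Comparing power sums through Mellin integrals\<close>

lemma Mellin_integral_scale:
  fixes g :: "real \<Rightarrow> real"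
  assumes [measurable]: "g \<in> borel_measurable borel" and "g 0 = 0" and "0 \<le> c"
  shows "(\<integral>\<^sup>+t. ennreal (g (c * t) * t powr (-p-1)) * indicator {0<..} t \<partial>lborel)
       = ennreal (c powr p) * (\<integral>\<^sup>+t. ennreal (g t * t powr (-p-1)) * indicator {0<..} t \<partial>lborel)"
    (is "?L = _ * ?R")
proof (cases "c = 0")
  case False
  then have c: "0 < c" using assms(3) by simp
  have "?R = ennreal \<bar>c\<bar> * (\<integral>\<^sup>+t. ennreal (g (0 + c * t) * (0 + c * t) powr (-p-1))
                                 * indicator {0<..} (0 + c * t) \<partial>lborel)"
    using False by (intro nn_integral_real_affine) auto
  also have "(\<integral>\<^sup>+t. ennreal (g (0 + c * t) * (0 + c * t) powr (-p-1))
                       * indicator {0<..} (0 + c * t) \<partial>lborel)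
      = (\<integral>\<^sup>+t. ennreal (c powr (-p-1))
          * (ennreal (g (c * t) * t powr (-p-1)) * indicator {0<..} t) \<partial>lborel)"
    using c by (intro nn_integral_cong)
      (auto simp: indicator_def powr_mult zero_less_mult_iff ac_simps simp flip: ennreal_mult')
  also have "\<dots> = ennreal (c powr (-p-1)) * ?L"
    by (rule nn_integral_cmult) simp
  finally have "ennreal (c powr p) * ?R = ennreal (c powr p * (c * c powr (-p-1))) * ?L"
    using c by (simp add: ennreal_mult' mult.assoc)
  also have "c powr p * (c * c powr (-p-1)) = 1"
    using c by (simp add: powr_diff powr_minus field_simps)
  finally show ?thesis by simp
qed (simp add: assms)

lemma Mellin_integral_finite:
  fixes g :: "real \<Rightarrow> real"
  assumes [measurable]: "g \<in> borel_measurable borel"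
    and near_0: "\<And>t. 0 < t \<Longrightarrow> t \<le> 1 \<Longrightarrow> g t \<le> C * t powr a" "p < a"
    and near_top: "\<And>t. 1 \<le> t \<Longrightarrow> g t \<le> D * t powr b" "b < p"
  shows "(\<integral>\<^sup>+t. ennreal (g t * t powr (-p-1)) * indicator {0<..} t \<partial>lborel) < \<infinity>"
proof -
  let ?A = "\<lambda>t. ennreal (t powr (a-p-1)) * indicator {0..1} t"
  let ?B = "\<lambda>t. ennreal (t powr (b-p-1)) * indicator {1..} t"
  have "(\<integral>\<^sup>+t. ennreal (g t * t powr (-p-1)) * indicator {0<..} t \<partial>lborel)
      \<le> (\<integral>\<^sup>+t. ennreal \<bar>C\<bar> * ?A t + ennreal \<bar>D\<bar> * ?B t \<partial>lborel)"
  proof (rule nn_integral_mono)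
    fix t :: real
    have shift: "\<bar>K\<bar> * t powr e * t powr (-p-1) = \<bar>K\<bar> * t powr (e-p-1)" if "0 < t" for K e
      using that by (simp add: mult.assoc powr_add[symmetric] algebra_simps)
    have bound: "ennreal (g t * t powr (-p-1)) \<le> ennreal \<bar>K\<bar> * ennreal (t powr (e-p-1))"
      if "g t \<le> K * t powr e" "0 < t" for K e
    proof -
      have "g t \<le> \<bar>K\<bar> * t powr e"
        using that(1) by (rule order_trans) (intro mult_right_mono, auto)
      then have "g t * t powr (-p-1) \<le> \<bar>K\<bar> * t powr e * t powr (-p-1)"
        by (rule mult_right_mono) auto
      then show ?thesis
        unfolding shift[OF that(2)] by (simp add: ennreal_leI flip: ennreal_mult')
    qed
    show "ennreal (g t * t powr (-p-1)) * indicator {0<..} t \<le> ennreal \<bar>C\<bar> * ?A t + ennreal \<bar>D\<bar> * ?B t"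
    proof (cases "0 < t")
      case True
      show ?thesis
      proof (cases "t \<le> 1")
        case le: True
        show ?thesis using bound[OF near_0(1)] True le
          by (auto simp: indicator_def intro: add_increasing2)
      next
        case False
        then show ?thesis using bound[OF near_top(1)] True
          by (auto simp: indicator_def)
      qed
    qed simp
  qed
  also have "\<dots> = ennreal \<bar>C\<bar> * (\<integral>\<^sup>+t. ?A t \<partial>lborel) + ennreal \<bar>D\<bar> * (\<integral>\<^sup>+t. ?B t \<partial>lborel)"
    by (simp add: nn_integral_add nn_integral_cmult)
  also have "\<dots> < \<infinity>"
    using nn_integral_has_integral_lebesgue'[OF _ has_integral_powr_from_0[of "a-p-1" 1]]
      nn_integral_has_integral_lebesgue'[OF _ has_integral_powr_to_inf[of "b-p-1" 1]]
      near_0(2) near_top(2)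
    by (auto simp: ennreal_mult_less_top)
  finally show ?thesis .
qed

lemma Mellin_integral_pos:
  fixes g :: "real \<Rightarrow> real"
  assumes [measurable]: "g \<in> borel_measurable borel" and "\<And>t. 0 < t \<Longrightarrow> 0 < g t"
  shows "(\<integral>\<^sup>+t. ennreal (g t * t powr (-p-1)) * indicator {0<..} t \<partial>lborel) \<noteq> 0"
proof
  assume "(\<integral>\<^sup>+t. ennreal (g t * t powr (-p-1)) * indicator {0<..} t \<partial>lborel) = 0"
  then have "AE t in lborel. ennreal (g t * t powr (-p-1)) * indicator {0<..} t = 0"
    by (subst (asm) nn_integral_0_iff_AE) auto
  then have "AE t in lborel. t \<notin> {0<..<1::real}"
  proof eventually_elim
    case (elim t)
    show ?case
    proof
      assume "t \<in> {0<..<1}"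
      then have "0 < g t * t powr (-p-1)" using assms(2) by auto
      then show False using elim \<open>t \<in> _\<close> by (auto simp: indicator_def ennreal_eq_0_iff)
    qed
  qed
  then have "emeasure lborel {0<..<1::real} = 0"
    by (subst (asm) AE_iff_measurable[where N = "{0<..<1}"]) auto
  then show False by simp
qed

text \<open>
  The positive combination of the inequalities \<open>\<Sum>i. g (u\<^sub>i t) \<le> \<Sum>i. g (v\<^sub>i t)\<close> with weight
  \<open>t powr (-p-1)\<close> is \<open>M * \<Sum>i. u\<^sub>i powr p \<le> M * \<Sum>i. v\<^sub>i powr p\<close>, by scaling. The growth conditions
  put \<open>p\<close> inside the strip of convergence and so make \<open>M\<close> finite, and positivity of \<open>g\<close> makes it
  nonzero, so \<open>M\<close> cancels.
\<close>

lemma sum_powr_le_by_Mellin: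
  fixes g :: "real \<Rightarrow> real" and u v :: "'i \<Rightarrow> real"
  assumes meas [measurable]: "g \<in> borel_measurable borel"
    and g0: "g 0 = 0" and g_pos: "\<And>t. 0 < t \<Longrightarrow> 0 < g t"
    and near_0: "\<And>t. 0 < t \<Longrightarrow> t \<le> 1 \<Longrightarrow> g t \<le> C * t powr a" "p < a"
    and near_top: "\<And>t. 1 \<le> t \<Longrightarrow> g t \<le> D * t powr b" "b < p"
    and u: "\<And>i. i \<in> I \<Longrightarrow> 0 \<le> u i" and v: "\<And>i. i \<in> I \<Longrightarrow> 0 \<le> v i"
    and le: "\<And>t. 0 < t \<Longrightarrow> (\<Sum>i\<in>I. g (u i * t)) \<le> (\<Sum>i\<in>I. g (v i * t))"
  shows "(\<Sum>i\<in>I. u i powr p) \<le> (\<Sum>i\<in>I. v i powr p)"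
proof -
  define M where "M = (\<integral>\<^sup>+t. ennreal (g t * t powr (-p-1)) * indicator {0<..} t \<partial>lborel)"
  have M: "M \<noteq> 0" "M \<noteq> top"
    using Mellin_integral_pos[OF meas g_pos] Mellin_integral_finite[OF meas near_0 near_top]
    by (auto simp: M_def)
  have g_nonneg: "0 \<le> g t" if "0 \<le> t" for t
    using g0 g_pos[of t] that by (cases "t = 0") auto
  have eq: "M * ennreal (\<Sum>i\<in>I. w i powr p)
      = (\<integral>\<^sup>+t. ennreal ((\<Sum>i\<in>I. g (w i * t)) * t powr (-p-1)) * indicator {0<..} t \<partial>lborel)"
    if w: "\<forall>i\<in>I. 0 \<le> w i" for w
  proof -
    have "M * ennreal (\<Sum>i\<in>I. w i powr p) = (\<Sum>i\<in>I. ennreal (w i powr p) * M)"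
      by (simp add: sum_distrib_left mult.commute flip: sum_ennreal)
    also have "\<dots> = (\<Sum>i\<in>I. \<integral>\<^sup>+t. ennreal (g (w i * t) * t powr (-p-1)) * indicator {0<..} t \<partial>lborel)"
      unfolding M_def using w by (intro sum.cong Mellin_integral_scale[symmetric] meas g0) auto
    also have "\<dots> = (\<integral>\<^sup>+t. (\<Sum>i\<in>I. ennreal (g (w i * t) * t powr (-p-1)) * indicator {0<..} t) \<partial>lborel)"
      by (rule nn_integral_sum[symmetric]) simp
    also have "\<dots> = (\<integral>\<^sup>+t. ennreal ((\<Sum>i\<in>I. g (w i * t)) * t powr (-p-1)) * indicator {0<..} t \<partial>lborel)"
      by (intro nn_integral_cong)
        (auto simp: indicator_def sum_distrib_right sum_ennreal g_nonneg w)
    finally show ?thesis .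
  qed
  have u': "\<forall>i\<in>I. 0 \<le> u i" and v': "\<forall>i\<in>I. 0 \<le> v i"
    using u v by auto
  have "M * ennreal (\<Sum>i\<in>I. u i powr p) \<le> M * ennreal (\<Sum>i\<in>I. v i powr p)"
    unfolding eq[OF u'] eq[OF v'] using le
    by (intro nn_integral_mono) (auto simp: indicator_def intro!: ennreal_leI mult_right_mono)
  then show ?thesis
    using M by (simp add: ennreal_mult_le_mult_iff sum_nonneg)
qed

section \<open>From products of truncated exponentials to power sums\<close>

lemma measurable_exp_trunc [measurable]: "exp_trunc r \<in> borel_measurable borel"
  unfolding exp_trunc_def by measurable

text \<open>
  After taking logarithms this is \<open>sum_powr_le_by_Mellin\<close> for \<open>g t = ln (exp_trunc r t)\<close>, and for
  \<open>g t = t - ln (exp_trunc r t)\<close> with the two families exchanged.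
\<close>

lemma
  fixes u v :: "'i \<Rightarrow> real"
  assumes "finite I" "1 \<le> r" and u: "\<And>i. i \<in> I \<Longrightarrow> 0 \<le> u i" and v: "\<And>i. i \<in> I \<Longrightarrow> 0 \<le> v i"
    and le: "\<And>t. 0 < t \<Longrightarrow>
      (\<Prod>i\<in>I. exp_trunc r (u i * t)) \<le> (\<Prod>i\<in>I. exp_trunc r (v i * t))"
  shows sum_powr_le_below_1: "0 < p \<Longrightarrow> p < 1 \<Longrightarrow> (\<Sum>i\<in>I. u i powr p) \<le> (\<Sum>i\<in>I. v i powr p)"
    and sum_powr_ge_above_1: "(\<Sum>i\<in>I. u i) = (\<Sum>i\<in>I. v i) \<Longrightarrow> 1 < p \<Longrightarrow> p < real r + 1 \<Longrightarrow>
      (\<Sum>i\<in>I. v i powr p) \<le> (\<Sum>i\<in>I. u i powr p)"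
proof -
  have ge_1: "1 \<le> exp_trunc r (w i * t)" if "\<And>i. i \<in> I \<Longrightarrow> 0 \<le> w i" "i \<in> I" "0 < t" for w i t
    using that by (intro exp_trunc_ge_1) auto
  have ln_prod_eq: "ln (\<Prod>i\<in>I. exp_trunc r (w i * t)) = (\<Sum>i\<in>I. ln (exp_trunc r (w i * t)))"
    if "\<And>i. i \<in> I \<Longrightarrow> 0 \<le> w i" "0 < t" for w t
    using \<open>finite I\<close> by (rule ln_prod) (use ge_1[of w, OF that(1)] that(2) in force)
  have log_le: "(\<Sum>i\<in>I. ln (exp_trunc r (u i * t))) \<le> (\<Sum>i\<in>I. ln (exp_trunc r (v i * t)))"
    if "0 < t" for t
  proof -
    have "0 < (\<Prod>i\<in>I. exp_trunc r (u i * t))"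
      using ge_1[of u, OF u _ that] by (intro prod_pos) force
    then show ?thesis
      using le[OF that] by (simp add: ln_prod_eq[of u, OF u that, symmetric]
          ln_prod_eq[of v, OF v that, symmetric] ln_mono)
  qed
  have ln_less: "ln (exp_trunc r t) < t" if "0 < t" for t
    using exp_trunc_remainder(1)[OF that] exp_trunc_ge_1[of t r] that
    by (metis less_imp_le ln_exp ln_less_cancel_iff exp_gt_zero less_le_trans zero_less_one)

  \<comment> \<open>Any growth exponent strictly between \<open>0\<close> and \<open>p\<close> would serve for the tail; take \<open>p / 2\<close>.\<close>
  show "(\<Sum>i\<in>I. u i powr p) \<le> (\<Sum>i\<in>I. v i powr p)" if "0 < p" "p < 1"
  proof (rule sum_powr_le_by_Mellin[where g = "\<lambda>t. ln (exp_trunc r t)" and a = 1 and C = 1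
          and b = "p / 2" and D = "1 + r / (p / 2)"])
    show "0 < ln (exp_trunc r t)" if "0 < t" for t
      using exp_trunc_gt_1[OF \<open>1 \<le> r\<close> that] by simp
    show "ln (exp_trunc r t) \<le> 1 * t powr 1" if "0 < t" for t
      using ln_less[OF that] that by simp
    show "ln (exp_trunc r t) \<le> (1 + r / (p / 2)) * t powr (p / 2)" if "1 \<le> t" for t
      using \<open>0 < p\<close> that by (intro ln_exp_trunc_bound_at_top) auto
  qed (use that u v log_le in \<open>auto simp: exp_trunc_0\<close>)

  \<comment> \<open>The linear terms have equal sums, so here \<open>v\<close> is the smaller side.\<close>
  show "(\<Sum>i\<in>I. v i powr p) \<le> (\<Sum>i\<in>I. u i powr p)"
    if sums: "(\<Sum>i\<in>I. u i) = (\<Sum>i\<in>I. v i)" and p: "1 < p" "p < real r + 1"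
  proof (rule sum_powr_le_by_Mellin[where g = "\<lambda>t. t - ln (exp_trunc r t)"
          and a = "real r + 1" and C = "exp 1" and b = 1 and D = 1])
    fix t :: real
    show "0 < t - ln (exp_trunc r t)" if "0 < t"
      using ln_less[OF that] by simp
    show "t - ln (exp_trunc r t) \<le> 1 * t powr 1" if "1 \<le> t"
      using exp_trunc_ge_1[of t r] that by simp
    show "t - ln (exp_trunc r t) \<le> exp 1 * t powr (real r + 1)" if t: "0 < t" "t \<le> 1"
    proof -
      have E: "1 \<le> exp_trunc r t" using t by (intro exp_trunc_ge_1) simp
      have "t - ln (exp_trunc r t) = ln (exp t / exp_trunc r t)"
        using E by (simp add: ln_div)
      also have "\<dots> \<le> exp t / exp_trunc r t - 1"
        using E by (intro ln_le_minus_one) simp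
      also have "\<dots> = (exp t - exp_trunc r t) / exp_trunc r t"
        using E by (simp add: diff_divide_distrib)
      also have "\<dots> \<le> (exp t - exp_trunc r t) / 1"
        using E exp_trunc_remainder(1)[OF t(1), of r] by (intro divide_left_mono) auto
      also have "\<dots> \<le> exp t * t ^ Suc r"
        using exp_trunc_remainder(2)[OF t(1), of r] by simp
      also have "\<dots> \<le> exp 1 * t ^ Suc r"
        using t by (intro mult_right_mono) auto
      also have "t ^ Suc r = t powr (real r + 1)"
        using powr_realpow[OF t(1), of "Suc r"] by (simp add: add.commute)
      finally show ?thesis .
    qed
    show "(\<Sum>i\<in>I. v i * t - ln (exp_trunc r (v i * t))) \<le> (\<Sum>i\<in>I. u i * t - ln (exp_trunc r (u i * t)))"
      if "0 < t"
      using log_le[OF that] sums by (simp add: sum_subtractf flip: sum_distrib_right)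
  qed (use p u v in \<open>auto simp: exp_trunc_0\<close>)
qed

text \<open>
  A zero base is harmless because \<open>0 powr p = 0\<close> for every \<open>p\<close>, so that term is constant.
\<close>

lemma continuous_sum_powr_exponent:
  fixes u :: "'i \<Rightarrow> real"
  shows "continuous_on {0<..} (\<lambda>p. \<Sum>i\<in>I. u i powr p)"
proof (intro continuous_on_sum)
  fix i
  show "continuous_on {0<..} (\<lambda>p. u i powr p)"
    by (cases "u i = 0") (auto intro!: continuous_intros)
qed

section \<open>Norm inequalities from coefficient inequalities\<close>

theorem theorem1:
  fixes x y :: "real ^ 'n" and r :: nat
  assumes "\<And>i. 0 \<le> x $ i" and "\<And>i. 0 \<le> y $ i"
    and "1 \<le> r"
    and "\<And>k. r \<le> k \<Longrightarrow> k \<le> CARD('n) * r \<Longrightarrow> F k r x \<le> F k r y"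
  shows "(\<forall>p. 0 \<le> p \<and> p \<le> 1 \<longrightarrow> pnorm p x \<le> pnorm p y) \<and>
         ((\<Sum>i\<in>UNIV. x $ i) = (\<Sum>i\<in>UNIV. y $ i) \<longrightarrow>
           (\<forall>p. 1 \<le> p \<and> p \<le> real r + 1 \<longrightarrow> pnorm p x \<ge> pnorm p y))"
proof -
  note x = assms(1) and y = assms(2) and r = assms(3) and F_le = assms(4)
  let ?s = "\<lambda>p (z :: real ^ 'n). \<Sum>i\<in>UNIV. z $ i powr p"
  have pnorm_mono: "pnorm p z \<le> pnorm p w" if "0 < p" "?s p z \<le> ?s p w" for p and z w :: "real ^ 'n"
    using that by (auto simp: pnorm_def intro!: powr_mono2 sum_nonneg)

  have "F r r x \<le> F r r y" using F_le[of r] by simp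
  then have "(\<Sum>i\<in>UNIV. x $ i) ^ r \<le> (\<Sum>i\<in>UNIV. y $ i) ^ r"
    by (simp add: F_low_degree divide_le_cancel)
  then have sum_le: "(\<Sum>i\<in>UNIV. x $ i) \<le> (\<Sum>i\<in>UNIV. y $ i)"
    using r y by (subst (asm) power_mono_iff) (auto intro!: sum_nonneg x)
  have "F k r x \<le> F k r y" if "k \<le> CARD('n) * r" for k
  proof (cases "r \<le> k")
    case False
    then show ?thesis
      using sum_le by (auto simp: F_low_degree intro!: divide_right_mono power_mono sum_nonneg x)
  qed (use F_le that in auto)
  then have prod_le: "(\<Prod>i\<in>UNIV. exp_trunc r (x $ i * t)) \<le> (\<Prod>i\<in>UNIV. exp_trunc r (y $ i * t))"
    if "0 < t" for t
    using that by (auto simp: F_generating_function intro!: sum_mono mult_right_mono)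

  have "pnorm p x \<le> pnorm p y" if p: "0 \<le> p" "p \<le> 1" for p
  proof -
    consider "p = 0" | "0 < p" "p < 1" | "p = 1" using p by linarith
    then show ?thesis
    proof cases
      case 1
      have "F (CARD('n) * r) r x \<le> F (CARD('n) * r) r y"
        using F_le by simp
      then have "(\<Prod>i\<in>UNIV. x $ i) ^ r \<le> (\<Prod>i\<in>UNIV. y $ i) ^ r"
        by (simp add: F_top_degree divide_le_cancel)
      then have "(\<Prod>i\<in>UNIV. x $ i) \<le> (\<Prod>i\<in>UNIV. y $ i)"
        using r by (subst (asm) power_mono_iff) (auto intro!: prod_nonneg x y)
      then show ?thesis
        using 1 by (auto simp: pnorm_def intro!: powr_mono2 prod_nonneg x)
    next
      case 2
      then show ?thesis
        using sum_powr_le_below_1[OF _ r x y prod_le] by (intro pnorm_mono) auto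
    next
      case 3
      then show ?thesis using sum_le by (intro pnorm_mono) (auto simp: x y)
    qed
  qed
  moreover have "pnorm p y \<le> pnorm p x"
    if sums: "(\<Sum>i\<in>UNIV. x $ i) = (\<Sum>i\<in>UNIV. y $ i)" and p: "1 \<le> p" "p \<le> real r + 1" for p
  proof (rule pnorm_mono)
    have inner: "?s q y \<le> ?s q x" if "q \<in> {1<..<real r + 1}" for q
      using sum_powr_ge_above_1[OF _ r x y prod_le sums] that by auto
    have cont: "((\<lambda>q. ?s q z) \<longlongrightarrow> ?s (real r + 1) z) (at_left (real r + 1))" for z :: "real ^ 'n"
    proof -
      have "isCont (\<lambda>q. ?s q z) (real r + 1)"
        using continuous_sum_powr_exponent by (rule continuous_on_interior) (simp add: interior_open)
      then show ?thesis
        unfolding isCont_def by (rule filterlim_mono) (auto intro: at_le)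
    qed
    consider "p = 1" | "p \<in> {1<..<real r + 1}" | "p = real r + 1" using p by fastforce
    then show "?s p y \<le> ?s p x"
    proof cases
      case 1
      then show ?thesis using sums by (simp add: x y)
    next
      case 3
      have "eventually (\<lambda>q. ?s q y \<le> ?s q x) (at_left (real r + 1))"
        using eventually_at_left_real[of 1 "real r + 1"] r inner by (auto elim: eventually_mono)
      then show ?thesis
        unfolding 3 by (intro tendsto_le[OF _ cont cont]) auto
    qed (rule inner)
  qed (use p in simp)
  ultimately show ?thesis by blast
qed

end
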